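(* Let $n\ge 1$ and $k\ge 1$ be integers, let $\sigma\in\mathfrak{S}_n$, and let $\pi=\mathrm{cycle}_{-1}(\sigma)$ be the image of $\sigma$ under the map $\mathrm{cycle}_{-1}:\mathfrak{S}_n\to\mathfrak{S}_n$. Then $\mathrm{exc}_k(\sigma)=\widetilde{\mathrm{des}_{k+1}}'(\pi)$.
   Context: $\mathfrak{S}_n$ is the set of permutations of $\{1,\dots,n\}$, written as words $\sigma(1)\sigma(2)\cdots\sigma(n)$. Statistics: for $k\ge1$ and $\sigma\in\mathfrak{S}_n$, $\mathrm{exc}_k(\sigma)=\#\{i\in\{1,\dots,n\}:\sigma(i)\ge i+k\}$ and $\mathrm{des}_k(\sigma)=\#\{i\in\{1,\dots,n-1\}:\sigma(i)\ge\sigma(i+1)+k\}$. Also $\widetilde{\mathrm{des}_k}'(\sigma)=\mathrm{des}_k(\sigma)$ if $\sigma(n)<k$, and $\widetilde{\mathrm{des}_k}'(\sigma)=\mathrm{des}_k(\sigma)+1$ if $\sigma(n)\ge k$. The map $\mathrm{cycle}_{-1}$: given $\sigma\in\mathfrak{S}_n$, let $G$ be the directed graph with vertex set $\{0,1,\dots,n\}$ and, for each $i\in\{1,\dots,n\}$, a directed edge from $\sigma(i)$ to $i-1$. Every vertex except $0$ has exactly one outgoing edge and every vertex except $n$ has exactly one incoming edge, so $G$ is a disjoint union of directed cycles (possibly loops) and one directed path from $n$ to $0$. Write each cycle as the list of its vertices in the order obtained by following the edges, starting from its largest element; list the cycles in increasing order of their first (largest) elements; after all cycles, write the vertices of the path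 from $n$ to $0$ in order along the path. Erasing the separators between cycles/path and deleting the final $0$ gives a word $\pi(1)\cdots\pi(n)$, which is the permutation $\pi=\mathrm{cycle}_{-1}(\sigma)\in\mathfrak{S}_n$. For example $\sigma=7\,8\,3\,5\,1\,2\,4\,9\,6$ gives $(5\,3\,2)(8\,1\,4\,6)(9\,7\,0)$ and $\pi=5\,3\,2\,8\,1\,4\,6\,9\,7$. *)

theory Defs
  imports "HOL-Combinatorics.Permutations"
begin

text \<open>A permutation of \<open>{1..n}\<close> is a function \<open>\<sigma> :: nat \<Rightarrow> nat\<close> with \<open>\<sigma> permutes {1..n}\<close>;
  its word is \<open>\<sigma> 1, \<dots>, \<sigma> n\<close>.\<close>

definition exc :: "nat \<Rightarrow> nat \<Rightarrow> (nat \<Rightarrow> nat) \<Rightarrow> nat" where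
  "exc k n \<sigma> = card {i \<in> {1..n}. \<sigma> i \<ge> i + k}"

definition des :: "nat \<Rightarrow> nat \<Rightarrow> (nat \<Rightarrow> nat) \<Rightarrow> nat" where
  "des k n \<sigma> = card {i \<in> {1..n - 1}. \<sigma> i \<ge> \<sigma> (i + 1) + k}"

definition des_tilde' :: "nat \<Rightarrow> nat \<Rightarrow> (nat \<Rightarrow> nat) \<Rightarrow> nat" where
  "des_tilde' k n \<sigma> = (if \<sigma> n < k then des k n \<sigma> else des k n \<sigma> + 1)"

definition cycle_edges :: "nat \<Rightarrow> (nat \<Rightarrow> nat) \<Rightarrow> (nat \<times> nat) set" where
  "cycle_edges n \<sigma> = {(\<sigma> i, i - 1) | i. i \<in> {1..n}}"

text \<open>The directed cycles of a graph, each written as the list of its vertices along the edges,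
  starting from the largest one; a loop at \<open>v\<close> is the list \<open>[v]\<close>.\<close>

definition cycle_words :: "(nat \<times> nat) set \<Rightarrow> nat list set" where
  "cycle_words E = {c. c \<noteq> [] \<and> distinct c \<and> successively (\<lambda>u v. (u, v) \<in> E) c
     \<and> (last c, hd c) \<in> E \<and> hd c = Max (set c)}"

definition is_path :: "(nat \<times> nat) set \<Rightarrow> nat \<Rightarrow> nat \<Rightarrow> nat list \<Rightarrow> bool" where
  "is_path E u v p \<longleftrightarrow> p \<noteq> [] \<and> distinct p \<and> successively (\<lambda>x y. (x, y) \<in> E) p
     \<and> hd p = u \<and> last p = v"

text \<open>For \<open>\<sigma> permutes {1..n}\<close> every vertex of \<open>cycle_edges n \<sigma>\<close> except \<open>0\<close> has exactly one
  outgoing edge, so distinct cycles have distinct heads and the path from \<open>n\<close> to \<open>0\<close> is unique;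
  \<open>butlast\<close> deletes its final \<open>0\<close>.\<close>

definition cycle_m1_word :: "nat \<Rightarrow> (nat \<Rightarrow> nat) \<Rightarrow> nat list" where
  "cycle_m1_word n \<sigma> =
     concat (sorted_key_list_of_set hd (cycle_words (cycle_edges n \<sigma>)))
     @ butlast (THE p. is_path (cycle_edges n \<sigma>) n 0 p)"

definition cycle_m1 :: "nat \<Rightarrow> (nat \<Rightarrow> nat) \<Rightarrow> (nat \<Rightarrow> nat)" where
  "cycle_m1 n \<sigma> = (\<lambda>i. if i \<in> {1..n} then cycle_m1_word n \<sigma> ! (i - 1) else i)"

end

theory Submission
  imports Defs "HOL-Combinatorics.Cycles"
begin

text \<open>Add the edge from \<open>0\<close> back to \<open>n\<close>. The graph becomes that of a permutation \<open>\<tau>\<close> of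
  \<open>{0..n}\<close> with \<open>\<tau> (\<sigma> i) = i - 1\<close>, the path becomes the cycle with the largest head \<open>n\<close>, and the
  word of \<open>\<pi>\<close> followed by \<open>0\<close> is the concatenation of all cycles of \<open>\<tau>\<close> by increasing head. The
  closing edge of a cycle goes weakly up, as does the step from the end of a cycle to the next,
  larger head. So the consecutive letters \<open>u, v\<close> with \<open>u \<ge> v + k + 1\<close> are exactly the edges
  \<open>(\<sigma> i, i - 1)\<close> with \<open>\<sigma> i \<ge> i + k\<close>.\<close>

text \<open>The key \<open>hd\<close> is injective on cycle words but not on all lists, so the
  sorting locale is interpreted with \<open>A\<close> itself as carrier.\<close>

lemma (in linorder) sorted_key_list_of_set_inj_on:
  assumes "inj_on f A" and "finite A"
  shows "set (sorted_key_list_of_set f A) = A" and "sorted (map f (sorted_key_list_of_set f A))"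
    and "distinct (sorted_key_list_of_set f A)"
proof -
  interpret folding_insort_key "(\<le>)" "(<)" A f
    by unfold_locales (rule assms(1))
  show "set (sorted_key_list_of_set f A) = A" "sorted (map f (sorted_key_list_of_set f A))"
    "distinct (sorted_key_list_of_set f A)"
    using assms(2) distinct_sorted_key_list_of_set[of A] by (simp_all add: distinct_map)
qed

section \<open>Cycles of the graph of a function\<close>

text \<open>Following \<open>f\<close> from the head closes up after \<open>length c\<close> steps,
  and distinctness excludes an earlier return, so the length is the least period. This links cycle
  words to the library's orbits.\<close>

lemma cycle_word_eq_support:
  assumes c: "c \<in> cycle_words {(x, f x) | x. x \<in> A}"
  shows "c = support f (hd c)"
proof -
  have ne: "c \<noteq> []" and dist: "distinct c" and succ: "successively (\<lambda>u v. v = f u) c"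
    and closed: "f (last c) = hd c"
    using c by (auto simp: cycle_words_def elim!: successively_mono)
  have nth: "i < length c \<Longrightarrow> c ! i = (f ^^ i) (hd c)" for i
  proof (induction i)
    case (Suc i)
    then show ?case using succ by (simp add: successively_conv_nth)
  qed (simp add: hd_conv_nth ne)
  have "(f ^^ length c) (hd c) = f (c ! (length c - 1))"
    using ne by (cases "length c") (simp_all add: nth)
  then have loop: "(f ^^ length c) (hd c) = hd c"
    using closed ne by (simp add: last_conv_nth)
  have "least_power f (hd c) = length c"
  proof (rule ccontr)
    assume ne': "least_power f (hd c) \<noteq> length c"
    define m where "m = least_power f (hd c)"
    have m: "0 < m" "(f ^^ m) (hd c) = hd c" "m < length c"
      using ne' ne least_powerI[OF loop] least_power_le[OF loop] by (auto simp: m_def)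
    then have "c ! m = c ! 0" using nth[OF m(3)] ne by (simp add: hd_conv_nth)
    then show False using m nth_eq_iff_index_eq[OF dist, of m 0] ne by auto
  qed
  then have period: "length (support f (hd c)) = length c" by simp
  show ?thesis
  proof (rule nth_equalityI)
    show "c ! i = support f (hd c) ! i" if "i < length c" for i
      using that period nth[OF that] by simp
  qed (simp only: period)
qed

lemma cycle_word_hd_ge: "c \<in> cycle_words E \<Longrightarrow> x \<in> set c \<Longrightarrow> x \<le> hd c"
  by (auto simp: cycle_words_def)

lemma cycle_word_hd_in: "c \<in> cycle_words E \<Longrightarrow> hd c \<in> set c"
  by (simp add: cycle_words_def)

text \<open>A converse of \<open>cycle_word_eq_support\<close>: orbits of a permutation close up,
  and \<open>max\<close> supplies the normalization of the head.\<close>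

lemma support_in_cycle_words:
  assumes f: "f permutes A" and A: "finite A" and x: "x \<in> A"
    and max: "\<And>y. y \<in> set (support f x) \<Longrightarrow> y \<le> x"
  shows "support f x \<in> cycle_words {(x, f x) | x. x \<in> A}" and "hd (support f x) = x"
proof -
  let ?m = "least_power f x"
  have perm: "permutation f"
    using f A by (auto simp: permutation_permutes)
  have m: "0 < ?m" "(f ^^ ?m) x = x"
    using least_power_of_permutation[OF perm] by auto
  have in_A: "(f ^^ i) x \<in> A" for i
    using permutes_in_image[OF permutes_funpow[OF f]] x by blast
  show hd: "hd (support f x) = x"
    using m by (simp add: hd_map upt_rec)
  have "f (last (support f x)) = x"
    using m by (cases ?m) simp_all
  moreover have "last (support f x) \<in> A"
    using m in_A by (cases ?m) simp_all
  moreover have "distinct (support f x)"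
    by (rule cycle_of_permutation[OF perm])
  moreover have "x = Max (set (support f x))"
  proof -
    have "x \<in> set (support f x)" using hd m hd_in_set[of "support f x"] by simp
    then show ?thesis using max by (intro Max_eqI[symmetric]) auto
  qed
  ultimately show "support f x \<in> cycle_words {(x, f x) | x. x \<in> A}"
    using m in_A unfolding cycle_words_def mem_Collect_eq hd
    by (auto simp: successively_conv_nth)
qed

lemma inj_on_hd_cycle_words:
  "inj_on hd (cycle_words {(x, f x) | x. x \<in> A})"
proof (rule inj_onI)
  fix b c assume "b \<in> cycle_words {(x, f x) | x. x \<in> A}" "c \<in> cycle_words {(x, f x) | x. x \<in> A}"
    and hd: "hd b = hd c"
  then have sup: "b = support f (hd b)" "c = support f (hd c)"
    by (blast intro: cycle_word_eq_support)+
  \<comment> \<open>As rewrite rules the equations in \<open>sup\<close> would loop, hence the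
    explicit transitivity.\<close>
  show "b = c"
    by (rule trans[OF sup(1)], rule trans[OF _ sup(2)[symmetric]]) (simp only: hd)
qed

text \<open>Orbits that meet coincide, so both words have the same maximum, which is their head, and
  the head determines the word.\<close>

lemma cycle_words_disjoint:
  assumes f: "permutation f"
    and b: "b \<in> cycle_words {(x, f x) | x. x \<in> A}" and c: "c \<in> cycle_words {(x, f x) | x. x \<in> A}"
    and meet: "set b \<inter> set c \<noteq> {}"
  shows "b = c"
proof -
  have sup: "b = support f (hd b)" "c = support f (hd c)"
    using b c by (blast intro: cycle_word_eq_support)+
  have "set b \<in> range (\<lambda>a. set (support f a))"
    by (rule range_eqI, rule arg_cong[OF sup(1)])
  moreover have "set c \<in> range (\<lambda>a. set (support f a))"
    by (rule range_eqI, rule arg_cong[OF sup(2)])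
  ultimately have "set b = set c"
    using disjointD[OF disjoint_support[OF f]] meet by blast
  then have "hd b = hd c"
    using b c by (auto simp: cycle_words_def)
  with b c show ?thesis by (intro inj_onD[OF inj_on_hd_cycle_words])
qed

text \<open>The orbit of \<open>x\<close> is rewritten to start at its maximum
  \<open>m\<close>.\<close>

lemma ex_cycle_word:
  fixes f :: "nat \<Rightarrow> nat"
  assumes f: "f permutes A" and A: "finite A" and x: "x \<in> A"
  shows "\<exists>c \<in> cycle_words {(x, f x) | x. x \<in> A}. x \<in> set c"
proof -
  define m where "m = Max (set (support f x))"
  have perm: "permutation f"
    using f A by (auto simp: permutation_permutes)
  have x_in: "x \<in> set (support f x)"
    unfolding support_set[OF perm] by (rule range_eqI[of _ _ 0]) simp
  then have m_in: "m \<in> set (support f x)"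
    unfolding m_def by (intro Max_in) auto
  then have eq: "set (support f m) = set (support f x)"
    using disjointD[OF disjoint_support[OF perm] rangeI rangeI] disjoint_support'[OF perm]
    by blast
  have "m \<in> A"
    using m_in permutes_in_image[OF permutes_funpow[OF f]] x by auto
  then have "support f m \<in> cycle_words {(x, f x) | x. x \<in> A}"
    by (rule support_in_cycle_words(1)[OF f A]) (simp only: eq, simp add: m_def)
  then show ?thesis using eq x_in by blast
qed

text \<open>The steps of the word inside a block follow \<open>f\<close>; the steps between blocks are ascents that
  replace the step of \<open>f\<close> from the last letter of a block back to its largest letter.\<close>

lemma successively_concat_cycle_words:
  assumes "set bs \<subseteq> cycle_words {(x, f x) | x. x \<in> A}" and "sorted (map hd bs)"
  shows "successively (\<lambda>u v. v = f u \<or> u \<le> v \<and> u \<le> f u) (concat bs)"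
  using assms
proof (induction bs)
  case (Cons b bs)
  have b: "b \<in> cycle_words {(x, f x) | x. x \<in> A}" using Cons.prems by simp
  have "successively (\<lambda>u v. v = f u \<or> u \<le> v \<and> u \<le> f u) b" "f (last b) = hd b" "b \<noteq> []"
    using b by (auto simp: cycle_words_def elim!: successively_mono)
  moreover have "last b \<le> hd b" using cycle_word_hd_ge[OF b] \<open>b \<noteq> []\<close> by simp
  moreover have "bs = [] \<or> hd b \<le> hd (concat bs)"
    using Cons.prems by (cases bs) (auto simp: cycle_words_def)
  moreover have "successively (\<lambda>u v. v = f u \<or> u \<le> v \<and> u \<le> f u) (concat bs)"
    using Cons by simp
  ultimately show ?case
    unfolding concat.simps successively_append_iff by (cases "bs = []") auto
qed simp

lemma successively_ex_next:
  "successively P xs \<Longrightarrow> x \<in> set xs \<Longrightarrow> x \<noteq> last xs \<Longrightarrow> \<exists>y. P x y"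
  by (induction P xs rule: successively.induct) (auto split: if_splits)

text \<open>Each letter is the source of an edge, the last one through the closing edge.\<close>

lemma cycle_word_subset:
  assumes "c \<in> cycle_words {(x, f x) | x. x \<in> A}"
  shows "set c \<subseteq> A"
proof
  fix y assume "y \<in> set c"
  with assms show "y \<in> A"
    using successively_ex_next[of "\<lambda>u v. (u, v) \<in> {(x, f x) | x. x \<in> A}" c y]
    by (cases "y = last c") (auto simp: cycle_words_def)
qed

lemma finite_cycle_words:
  assumes "finite A"
  shows "finite (cycle_words {(x, f x) | x. x \<in> A})"
proof (rule inj_on_finite[OF inj_on_hd_cycle_words _ assms])
  show "hd ` cycle_words {(x, f x) | x. x \<in> A} \<subseteq> A"
    by (rule image_subsetI, rule subsetD[OF cycle_word_subset cycle_word_hd_in])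
qed

section \<open>The graph closed up to a permutation\<close>

text \<open>This is the permutation \<tau> announced above, extended by the identity as
  \<open>permutes\<close> demands.\<close>

definition closing :: "nat \<Rightarrow> (nat \<Rightarrow> nat) \<Rightarrow> nat \<Rightarrow> nat" where
  "closing n \<sigma> u = (if u = 0 then n else if u \<le> n then inv \<sigma> u - 1 else u)"

context
  fixes n :: nat and \<sigma> :: "nat \<Rightarrow> nat"
  assumes \<sigma>: "\<sigma> permutes {1..n}"
begin

lemma closing_\<sigma>: "i \<in> {1..n} \<Longrightarrow> closing n \<sigma> (\<sigma> i) = i - 1"
  using permutes_in_image[OF \<sigma>, of i] by (auto simp: closing_def permutes_inverses[OF \<sigma>])

text \<open>Indexing the edges by their source gives them the form required by the lemmas on graphs
  of functions.\<close>

lemma cycle_edges_closing: "cycle_edges n \<sigma> = {(u, closing n \<sigma> u) | u. u \<in> {1..n}}"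
proof -
  have "\<exists>i \<in> {1..n}. \<sigma> i = u" if "u \<in> {1..n}" for u
    using permutes_image[OF \<sigma>] that by (metis imageE)
  then show ?thesis
    using closing_\<sigma> permutes_in_image[OF \<sigma>] unfolding cycle_edges_def by (auto; metis)
qed

lemma closing_permutes: "closing n \<sigma> permutes {0..n}"
proof (rule bij_imp_permutes)
  have inv: "inv \<sigma> u \<in> {1..n}" if "u \<in> {1..n}" for u
    using permutes_in_image[OF permutes_inv[OF \<sigma>]] that by blast
  have "inj_on (closing n \<sigma>) {0..n}"
  proof (rule inj_onI)
    fix u v assume uv: "u \<in> {0..n}" "v \<in> {0..n}" "closing n \<sigma> u = closing n \<sigma> v"
    show "u = v"
    \<comment> \<open>Only \<open>0\<close> is sent to \<open>n\<close>; the other vertices go to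
      \<open>inv \<sigma> u - 1 < n\<close>, where the subtraction does not truncate.\<close>
    proof (cases "u = 0 \<or> v = 0")
      case True
      then show ?thesis
        using uv inv[of u] inv[of v] by (auto simp: closing_def split: if_splits)
    next
      case False
      with uv have "inv \<sigma> u = inv \<sigma> v"
        using inv[of u] inv[of v] by (auto simp: closing_def)
      then show ?thesis
        using permutes_inverses(1)[OF \<sigma>] by metis
    qed
  qed
  moreover have "closing n \<sigma> u \<in> {0..n}" if "u \<in> {0..n}" for u
    using inv[of u] that by (auto simp: closing_def)
  ultimately show "bij_betw (closing n \<sigma>) {0..n} {0..n}"
    unfolding bij_betw_def by (intro conjI endo_inj_surj image_subsetI) simp_all
qed (simp add: closing_def)

lemma permutation_closing: "permutation (closing n \<sigma>)"
  unfolding permutation_permutes using closing_permutes by blast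

abbreviation closed_edges :: "(nat \<times> nat) set" where
  "closed_edges \<equiv> {(u, closing n \<sigma> u) | u. u \<in> {0..n}}"

text \<open>The added edge from \<open>0\<close> to \<open>n\<close> closes the path. Conversely,
  injectivity forces a cycle with head \<open>n\<close> to end in \<open>0\<close>, and removing its
  closing edge leaves a path.\<close>

lemma is_path_iff_cycle_word:
  "is_path (cycle_edges n \<sigma>) n 0 p \<longleftrightarrow> p \<in> cycle_words closed_edges \<and> hd p = n"
proof
  assume path: "is_path (cycle_edges n \<sigma>) n 0 p"
  have "x \<le> n" if "x \<in> set p" for x
    using path that successively_ex_next[of "\<lambda>u v. (u, v) \<in> cycle_edges n \<sigma>" p x]
    by (cases "x = 0") (auto simp: is_path_def cycle_edges_closing)
  then have "Max (set p) = n"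
    using path hd_in_set[of p] by (intro Max_eqI) (auto simp: is_path_def)
  moreover have "successively (\<lambda>u v. (u, v) \<in> closed_edges) p"
    using path by (auto simp: is_path_def cycle_edges_closing elim!: successively_mono)
  ultimately show "p \<in> cycle_words closed_edges \<and> hd p = n"
    using path by (auto simp: is_path_def cycle_words_def closing_def)
next
  assume p: "p \<in> cycle_words closed_edges \<and> hd p = n"
  then have ne: "p \<noteq> []" and dist: "distinct p"
    and "closing n \<sigma> (last p) = closing n \<sigma> 0"
    by (auto simp: cycle_words_def closing_def)
  then have last: "last p = 0"
    using permutes_inj[OF closing_permutes] by (simp add: inj_eq)
  have "(p ! i, p ! Suc i) \<in> cycle_edges n \<sigma>" if "Suc i < length p" for i
  proof -
    have "p ! i \<noteq> last p"
      using that ne dist by (simp add: last_conv_nth nth_eq_iff_index_eq)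
    moreover have "(p ! i, p ! Suc i) \<in> closed_edges"
      using p that by (auto simp: cycle_words_def successively_conv_nth)
    ultimately show ?thesis
      using last by (auto simp: cycle_edges_closing)
  qed
  then show "is_path (cycle_edges n \<sigma>) n 0 p"
    using p ne dist last by (simp add: is_path_def successively_conv_nth)
qed

text \<open>The cycle through the largest vertex \<open>n\<close> has head \<open>n\<close>, and its
  head determines it.\<close>

lemma ex1_path: "\<exists>!p. is_path (cycle_edges n \<sigma>) n 0 p"
proof -
  obtain c where c: "c \<in> cycle_words closed_edges" "n \<in> set c"
    using ex_cycle_word[OF closing_permutes, of n] by auto
  moreover have "hd c \<in> {0..n}"
    by (rule subsetD[OF cycle_word_subset[OF c(1)] cycle_word_hd_in[OF c(1)]])
  ultimately have "hd c = n"
    using cycle_word_hd_ge[OF c] by simp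
  then show ?thesis
    unfolding is_path_iff_cycle_word using c(1)
    by (intro ex1I[of _ c] inj_onD[OF inj_on_hd_cycle_words, of _ _ "closing n \<sigma>" "{0..n}"])
      simp_all
qed

text \<open>The only cycle through \<open>0\<close> is the closed path; a cycle that avoids
  \<open>0\<close> cannot use the added edge.\<close>

lemma cycle_words_closed_edges:
  assumes p: "is_path (cycle_edges n \<sigma>) n 0 p"
  shows "cycle_words closed_edges = insert p (cycle_words (cycle_edges n \<sigma>))"
proof (intro equalityI subsetI)
  fix c assume c: "c \<in> cycle_words closed_edges"
  show "c \<in> insert p (cycle_words (cycle_edges n \<sigma>))"
  proof (cases "0 \<in> set c")
    case True
    moreover have "p \<in> cycle_words closed_edges" "0 \<in> set p"
      using p is_path_iff_cycle_word[of p] last_in_set[of p] by (auto simp: is_path_def)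
    ultimately have "c = p"
      using c by (intro cycle_words_disjoint[OF permutation_closing, of c "{0..n}" p]) auto
    then show ?thesis by simp
  next
    case False
    have ne: "c \<noteq> []" using c by (simp add: cycle_words_def)
    have "successively (\<lambda>u v. (u, v) \<in> cycle_edges n \<sigma>) c"
    proof (rule successively_mono)
      show "successively (\<lambda>u v. (u, v) \<in> closed_edges) c"
        using c by (simp add: cycle_words_def)
      show "(u, v) \<in> cycle_edges n \<sigma>" if "u \<in> set c" "(u, v) \<in> closed_edges" for u v
        using that False by (cases "u = 0") (auto simp: cycle_edges_closing)
    qed
    moreover have "(last c, hd c) \<in> cycle_edges n \<sigma>"
      using c False last_in_set[OF ne]
      by (cases "last c = 0") (auto simp: cycle_words_def cycle_edges_closing)
    ultimately show ?thesis
      using c by (simp add: cycle_words_def)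
  qed
next
  fix c assume "c \<in> insert p (cycle_words (cycle_edges n \<sigma>))"
  then show "c \<in> cycle_words closed_edges"
  proof
    assume "c = p"
    then show ?thesis using p by (simp only: is_path_iff_cycle_word)
  next
    assume "c \<in> cycle_words (cycle_edges n \<sigma>)"
    then show ?thesis
      by (auto simp: cycle_words_def cycle_edges_closing elim!: successively_mono)
  qed
qed

section \<open>The word as a concatenation of cycles\<close>

text \<open>Appending \<open>0\<close> restores the letter cut off by \<open>butlast\<close>, which
  makes the path the last block; no head exceeds its head \<open>n\<close>.\<close>

lemma cycle_m1_word_blocks:
  obtains bs where "cycle_m1_word n \<sigma> @ [0] = concat bs"
    and "set bs = cycle_words closed_edges" and "sorted (map hd bs)" and "distinct bs"
proof -
  define C where "C = cycle_words (cycle_edges n \<sigma>)"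
  define p where "p = (THE p. is_path (cycle_edges n \<sigma>) n 0 p)"
  have p: "is_path (cycle_edges n \<sigma>) n 0 p"
    unfolding p_def by (rule theI'[OF ex1_path])
  have inj: "inj_on hd C" and fin: "finite C" and sub: "\<And>c. c \<in> C \<Longrightarrow> set c \<subseteq> {1..n}"
    using inj_on_hd_cycle_words[of "closing n \<sigma>" "{1..n}"]
      finite_cycle_words[of "{1..n}" "closing n \<sigma>"] cycle_word_subset[of _ "closing n \<sigma>" "{1..n}"]
    by (simp_all only: C_def cycle_edges_closing finite_atLeastAtMost)
  let ?cs = "sorted_key_list_of_set hd C"
  note cs = sorted_key_list_of_set_inj_on[OF inj fin]
  have "cycle_m1_word n \<sigma> @ [0] = concat (?cs @ [p])"
    using p append_butlast_last_id[of p] by (simp add: cycle_m1_word_def C_def p_def is_path_def)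
  moreover have "set (?cs @ [p]) = cycle_words closed_edges"
    unfolding cycle_words_closed_edges[OF p] using cs by (simp add: C_def)
  moreover have "sorted (map hd (?cs @ [p]))"
  proof -
    have "hd c \<le> n" if "c \<in> C" for c
      using that subsetD[OF sub[OF that] cycle_word_hd_in] by (simp add: C_def)
    then show ?thesis
      using p by (simp add: sorted_append cs is_path_def)
  qed
  \<comment> \<open>The path contains \<open>0\<close>, while the other blocks have letters in
    \<open>{1..n}\<close>.\<close>
  moreover have "distinct (?cs @ [p])"
    using sub[of p] p last_in_set[of p] by (fastforce simp: is_path_def cs)
  ultimately show thesis by (rule that)
qed

lemma cycle_m1_word_properties:
  fixes w defines "w \<equiv> cycle_m1_word n \<sigma> @ [0]"
  shows "distinct w" and "set w = {0..n}"
    and "successively (\<lambda>u v. v = closing n \<sigma> u \<or> u \<le> v \<and> u \<le> closing n \<sigma> u) w"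
proof -
  obtain bs where w: "w = concat bs" and set_bs: "set bs = cycle_words closed_edges"
    and sorted: "sorted (map hd bs)" and dist: "distinct bs"
    unfolding w_def by (rule cycle_m1_word_blocks)
  show "distinct w"
    unfolding w
  proof (rule distinct_concat[OF dist])
    show "distinct c" if "c \<in> set bs" for c
      using that by (simp add: set_bs cycle_words_def)
    show "set b \<inter> set c = {}" if "b \<in> set bs" "c \<in> set bs" "b \<noteq> c" for b c
      using that cycle_words_disjoint[OF permutation_closing] unfolding set_bs by blast
  qed
  show "set w = {0..n}"
  proof (intro equalityI subsetI)
    show "x \<in> {0..n}" if "x \<in> set w" for x
      using that cycle_word_subset[of _ "closing n \<sigma>" "{0..n}"] unfolding w set_concat set_bs by blast
    show "x \<in> set w" if "x \<in> {0..n}" for x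
      using ex_cycle_word[OF closing_permutes _ that] unfolding w set_concat set_bs by blast
  qed
  show "successively (\<lambda>u v. v = closing n \<sigma> u \<or> u \<le> v \<and> u \<le> closing n \<sigma> u) w"
    unfolding w
    by (rule successively_concat_cycle_words[where A = "{0..n}"]) (simp_all only: set_bs sorted order_refl)
qed

lemma length_cycle_m1_word: "length (cycle_m1_word n \<sigma>) = n"
  using distinct_card[OF cycle_m1_word_properties(1)] cycle_m1_word_properties(2) by simp

section \<open>Counting excedances and descents\<close>

text \<open>For \<open>u = \<sigma> i\<close> the index is
  \<open>i = closing n \<sigma> u + 1\<close>; this offset is the source of the shift from
  \<open>k\<close> to \<open>k + 1\<close>.\<close>

lemma exc_eq_card_closing:
  "exc k n \<sigma> = card {u \<in> {0..n}. u \<ge> closing n \<sigma> u + Suc k}"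
proof -
  have "bij_betw \<sigma> {i \<in> {1..n}. \<sigma> i \<ge> i + k} {u \<in> {0..n}. u \<ge> closing n \<sigma> u + Suc k}"
    unfolding bij_betw_def
  proof (intro conjI equalityI subsetI)
    show "inj_on \<sigma> {i \<in> {1..n}. \<sigma> i \<ge> i + k}"
      using permutes_inj[OF \<sigma>] by (rule inj_on_subset) simp
  next
    fix u assume "u \<in> \<sigma> ` {i \<in> {1..n}. \<sigma> i \<ge> i + k}"
    then obtain i where "i \<in> {1..n}" "u = \<sigma> i" "\<sigma> i \<ge> i + k" by blast
    then show "u \<in> {u \<in> {0..n}. u \<ge> closing n \<sigma> u + Suc k}"
      using closing_\<sigma>[of i] permutes_in_image[OF \<sigma>, of i] by auto
  next
    fix u assume u: "u \<in> {u \<in> {0..n}. u \<ge> closing n \<sigma> u + Suc k}"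
    then have "u \<in> {1..n}" by (cases "u = 0") (auto simp: closing_def)
    then have "u \<in> \<sigma> ` {1..n}" unfolding permutes_image[OF \<sigma>] .
    then obtain i where "i \<in> {1..n}" "u = \<sigma> i" by blast
    with u show "u \<in> \<sigma> ` {i \<in> {1..n}. \<sigma> i \<ge> i + k}"
      using closing_\<sigma>[of i] by auto
  qed
  then show ?thesis unfolding exc_def by (rule bij_betw_same_card)
qed

text \<open>The appended \<open>0\<close> turns the condition \<open>\<pi> n \<ge> k\<close> into a descent at position \<open>n\<close>.\<close>

lemma des_tilde'_eq_card_word:
  fixes w defines "w \<equiv> cycle_m1_word n \<sigma> @ [0]"
  assumes "n \<ge> 1"
  shows "des_tilde' k n (cycle_m1 n \<sigma>) = card {i. i < n \<and> w ! i \<ge> w ! Suc i + k}"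
proof -
  define \<pi> where "\<pi> = cycle_m1 n \<sigma>"
  have \<pi>: "\<pi> (Suc i) = w ! i" if "i < n" for i
    using that by (simp add: \<pi>_def cycle_m1_def w_def nth_append length_cycle_m1_word)
  have wn: "w ! n = 0"
    by (simp add: w_def nth_append length_cycle_m1_word)
  define D where "D = {i. i < n - 1 \<and> w ! i \<ge> w ! Suc i + k}"
  have "{i \<in> {1..n - 1}. \<pi> i \<ge> \<pi> (i + 1) + k} = Suc ` D"
  proof (intro equalityI subsetI)
    fix i assume "i \<in> {i \<in> {1..n - 1}. \<pi> i \<ge> \<pi> (i + 1) + k}"
    then show "i \<in> Suc ` D"
      using \<pi>[of i] \<pi>[of "i - 1"] by (cases i) (auto simp: D_def)
  qed (auto simp: D_def \<pi>)
  then have des: "des k n \<pi> = card D"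
    by (simp add: des_def card_image)
  have "{i. i < n \<and> w ! i \<ge> w ! Suc i + k} = (if \<pi> n < k then D else insert (n - 1) D)"
  proof (rule set_eqI)
    fix i
    consider "i < n - 1" | "i = n - 1" | "i \<ge> n" using \<open>n \<ge> 1\<close> by linarith
    then show "i \<in> {i. i < n \<and> w ! i \<ge> w ! Suc i + k} \<longleftrightarrow>
        i \<in> (if \<pi> n < k then D else insert (n - 1) D)"
      using \<pi>[of "n - 1"] wn \<open>n \<ge> 1\<close> by cases (auto simp: D_def)
  qed
  moreover have "finite D" "n - 1 \<notin> D" by (simp_all add: D_def)
  ultimately show ?thesis
    by (simp add: des_tilde'_def des flip: \<pi>_def)
qed

end

theorem proposition2p1:
  fixes n k :: nat and \<sigma> \<pi> :: "nat \<Rightarrow> nat"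
  assumes "n \<ge> 1" and "k \<ge> 1"
    and "\<sigma> permutes {1..n}"
    and "\<pi> = cycle_m1 n \<sigma>"
  shows "exc k n \<sigma> = des_tilde' (k + 1) n \<pi>"
proof -
  define w where "w = cycle_m1_word n \<sigma> @ [0]"
  let ?f = "closing n \<sigma>"
  note w = cycle_m1_word_properties[OF assms(3), folded w_def]
  have len: "length w = Suc n"
    by (simp add: w_def length_cycle_m1_word[OF assms(3)])
  \<comment> \<open>If the next letter is not the image under \<open>?f\<close>, then neither the
    next letter nor that image lies below \<open>w ! i\<close>, and both sides are false.\<close>
  have drop: "w ! i \<ge> w ! Suc i + Suc k \<longleftrightarrow> w ! i \<ge> ?f (w ! i) + Suc k" if "i < n" for i
    using w(3) len that by (fastforce simp: successively_conv_nth)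
  \<comment> \<open>Since \<open>w\<close> lists every vertex once, drops can be counted by position
    or by letter.\<close>
  have "bij_betw ((!) w) {i. i < n \<and> w ! i \<ge> w ! Suc i + Suc k}
      {u \<in> {0..n}. u \<ge> ?f u + Suc k}"
    unfolding bij_betw_def
  proof (intro conjI equalityI subsetI)
    show "inj_on ((!) w) {i. i < n \<and> w ! i \<ge> w ! Suc i + Suc k}"
      using w(1) len by (auto simp: inj_on_def nth_eq_iff_index_eq)
  next
    fix u assume "u \<in> (!) w ` {i. i < n \<and> w ! i \<ge> w ! Suc i + Suc k}"
    then obtain i where i: "i < n" "u = w ! i" "w ! i \<ge> w ! Suc i + Suc k" by blast
    moreover have "w ! i \<in> set w" using i len by simp
    ultimately show "u \<in> {u \<in> {0..n}. u \<ge> ?f u + Suc k}"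
      using drop w(2) by auto
  next
    fix u assume u: "u \<in> {u \<in> {0..n}. u \<ge> ?f u + Suc k}"
    then have "u \<in> set w" using w(2) by simp
    then obtain i where i: "i < Suc n" "u = w ! i" using len by (auto simp: in_set_conv_nth)
    \<comment> \<open>The only position without a successor carries \<open>0\<close>, which is too
      small to satisfy the condition on \<open>u\<close>.\<close>
    moreover have "w ! n = 0"
      by (simp add: w_def nth_append length_cycle_m1_word[OF assms(3)])
    ultimately have "i < n" using u by (cases "i = n") auto
    then show "u \<in> (!) w ` {i. i < n \<and> w ! i \<ge> w ! Suc i + Suc k}"
      using u i drop by auto
  qed
  then have "card {i. i < n \<and> w ! i \<ge> w ! Suc i + Suc k} = card {u \<in> {0..n}. u \<ge> ?f u + Suc k}"
    by (rule bij_betw_same_card)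
  then show ?thesis
    using des_tilde'_eq_card_word[OF assms(3,1), of "k + 1"] exc_eq_card_closing[OF assms(3), of k]
    by (simp add: w_def assms(4))
qed

end
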